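(* Let $1\le k\le n$ and let $Q=\sum_{s=0}^k\alpha_s\sigma_s$ with constants $\alpha_0,\dots,\alpha_k\ge0$, $\alpha_k>0$. Suppose there are an integer $N\ge k$ and a vector $b\in\mathbb{R}^N$ such that, for $m=0,1,\dots,k$, $$\frac{(n-k)!\,\alpha_{k-m}}{(n-k+m)!}=\sigma_m(b).$$ Then there are $k-1$ polynomials $S_1,\dots,S_{k-1}$ of the form $S_l=\sigma_l+\sum_{s=0}^{l-1}\beta^l_s\sigma_s$, with constants $\beta^l_s\ge0$, such that $(Q/S_l)^{1/(k-l)}$ is a concave function on $\Gamma_k$ for every $1\le l\le k-1$.
   Context: $\sigma_m$ denotes the $m$-th elementary symmetric polynomial (in $n$ variables for $Q$ and $S_l$, in $N$ variables for $\sigma_m(b)$), with $\sigma_0=1$; in particular the case $m=0$ of the coefficient condition is the normalization $\alpha_k=1$. $\Gamma_k=\{\lambda\in\mathbb{R}^n:\sigma_m(\lambda)>0,\ m=1,\dots,k\}$ is the Garding cone. *)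

theory Defs
  imports "HOL-Analysis.Analysis"
begin

(* The index set is explicit so that the same polynomial can be evaluated both at vectors
   of type real ^ 'n (with I = UNIV) and at tuples of variable length N (with I = {..<N}). *)
definition elem_sym :: "'i set \<Rightarrow> nat \<Rightarrow> ('i \<Rightarrow> real) \<Rightarrow> real" where
  "elem_sym I m x = (\<Sum>J | J \<subseteq> I \<and> card J = m. \<Prod>i\<in>J. x i)"

definition elem_sigma :: "nat \<Rightarrow> real ^ 'n \<Rightarrow> real" where
  "elem_sigma m x = elem_sym UNIV m (\<lambda>i. x $ i)"

definition Garding_cone :: "nat \<Rightarrow> (real ^ 'n) set" where
  "Garding_cone k = {x. \<forall>m\<in>{1..k}. elem_sigma m x > 0}"

end

theory Submission
  imports Defs
    "HOL-Complex_Analysis.Great_Picard"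
    "HOL-Computational_Algebra.Fundamental_Theorem_Algebra"
begin

text \<open>
  Write \<open>D\<close> for the derivative in the direction \<open>e = (1, \<dots>, 1)\<close>. Since
  \<open>D \<sigma>\<^sub>s = (n - s + 1) \<sigma>\<^sub>s\<^sub>-\<^sub>1\<close>, the hypothesis on the coefficients says exactly that
  \<open>Q = (\<Prod>i. 1 + b\<^sub>i D) \<sigma>\<^sub>k\<close>. With \<open>W\<^sub>l = (n - l)! (\<Prod>i. 1 + b\<^sub>i D) \<sigma>\<^sub>l\<close> one has
  \<open>D W\<^sub>l\<^sub>+\<^sub>1 = W\<^sub>l\<close>, and \<open>S\<^sub>l = W\<^sub>l / (n - l)!\<close> has the required form, its coefficients being
  nonnegative multiples of the \<open>\<sigma>\<^sub>m(b)\<close> with \<open>m \<le> k\<close>. Up to a positive constant, \<open>Q / S\<^sub>l\<close> is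
  the product of the \<open>k - l\<close> quotients \<open>W\<^sub>j\<^sub>+\<^sub>1 / W\<^sub>j\<close>, \<open>l \<le> j < k\<close>, and a geometric mean of
  positive concave functions is concave (\<open>concave_on_geometric_mean\<close>). So it suffices that each
  \<open>W\<^sub>l\<^sub>+\<^sub>1 / W\<^sub>l\<close> is concave on \<open>\<Gamma>\<^sub>k\<close> (\<open>concave_on_dsym_ratio\<close>).

  A function is concave when the set of points strictly below its graph is convex. For this
  quotient the set is cut out by \<open>W\<^sub>l\<^sub>+\<^sub>1(x) - y W\<^sub>l(x) > 0\<close>. Replace each \<open>b\<^sub>i\<close> by \<open>z b\<^sub>i\<close> to make this expression
  homogeneous in \<open>(x, z, y)\<close>. Along lines parallel to \<open>e\<close> it becomes
  \<open>(1 - y D) (\<Prod>i. 1 + z b\<^sub>i D) D\<^sup>n\<^sup>-\<^sup>l\<^sup>-\<^sup>1 (\<Prod>j. x\<^sub>j + t)\<close>, and all of these operators preserve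
  real-rootedness, whatever the signs of the \<open>b\<^sub>i\<close> (\<open>dsym_hyperbolic\<close>): the expression is
  hyperbolic in the direction \<open>(e, 0, 0)\<close>. The points below the graph over \<open>\<Gamma>\<^sub>k\<close> lie in its
  hyperbolicity cone (\<open>dsym_ratio_along_ray\<close>), and hyperbolicity cones are convex by Garding's
  theorem. The same argument with \<open>b = 0\<close> and \<open>y = 0\<close> shows that \<open>\<Gamma>\<^sub>k\<close> itself is convex
  (\<open>convex_Garding_cone\<close>).

  Convexity concerns two points at a time, so Garding's theorem is only needed for the
  restriction \<open>g(u, s, t) = p(u A + s B + t e)\<close> of a hyperbolic polynomial to three dimensions.
  It follows from stability: \<open>g\<close> has no zero with \<open>u\<close>, \<open>s\<close> and \<open>t\<close> all in the upper half-plane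
  (\<open>hyperbolic_imp_stable\<close>), and multiplying by \<open>\<i>\<close> turns the positive octant into such points.
\<close>

section \<open>Garding's theorem for three-dimensional pencils\<close>

text \<open>
  Zeros that depend continuously on a parameter and stay bounded can enter the upper half-plane
  only through the real axis. The parameters with a zero there form a closed set by compactness,
  and those without one form a closed set by Hurwitz's theorem, so connectedness of the unit
  interval decides.
\<close>
lemma nonvanishing_upper_half_plane_homotopy:
  fixes h :: "real \<Rightarrow> complex \<Rightarrow> complex"
  assumes cont: "continuous_on ({0..1} \<times> UNIV) (\<lambda>(\<mu>, s). h \<mu> s)"
    and hol: "\<And>\<mu>. \<mu> \<in> {0..1} \<Longrightarrow> h \<mu> holomorphic_on UNIV"
    and bnd: "\<And>\<mu> s. \<mu> \<in> {0..1} \<Longrightarrow> h \<mu> s = 0 \<Longrightarrow> norm s \<le> R"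
    and real: "\<And>\<mu> x. \<mu> \<in> {0..1} \<Longrightarrow> h \<mu> (of_real x) \<noteq> 0"
    and start: "\<And>s. Im s > 0 \<Longrightarrow> h 0 s \<noteq> 0"
    and s: "Im s > 0"
  shows "h 1 s \<noteq> 0"
proof -
  define U where "U = {s. Im s > 0}"
  define M where "M = {\<mu> \<in> {0..1}. \<forall>s\<in>U. h \<mu> s \<noteq> 0}"
  define B where "B = {\<mu> \<in> {0..1}. \<exists>s\<in>U. h \<mu> s = 0}"
  define Z where "Z = {p \<in> {0..1} \<times> (cball 0 R \<inter> {s. Im s \<ge> 0}). (case p of (\<mu>, s) \<Rightarrow> h \<mu> s) = 0}"
  have "compact ({0..1::real} \<times> (cball 0 R \<inter> {s. Im s \<ge> 0}))"
    by (intro compact_Times compact_Icc compact_Int_closed compact_cball closed_halfspace_Im_ge)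
  moreover have "closed Z"
    unfolding Z_def
    by (intro continuous_closed_preimage_constant continuous_on_subset[OF cont] closed_Times
        closed_Int closed_cball closed_halfspace_Im_ge closed_atLeastAtMost) auto
  moreover have "Z \<subseteq> {0..1::real} \<times> (cball 0 R \<inter> {s. Im s \<ge> 0})"
    by (auto simp: Z_def)
  ultimately have "compact Z"
    by (metis Int_absorb1 compact_Int_closed)
  moreover have "B = fst ` Z"
  proof (intro equalityI subsetI)
    fix \<mu> assume "\<mu> \<in> B"
    then obtain s where s: "\<mu> \<in> {0..1}" "Im s > 0" "h \<mu> s = 0"
      by (auto simp: B_def U_def)
    then have "(\<mu>, s) \<in> Z"
      using bnd[OF s(1,3)] by (auto simp: Z_def)
    then show "\<mu> \<in> fst ` Z" by force
  next
    fix \<mu> assume "\<mu> \<in> fst ` Z"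
    then obtain s where s: "\<mu> \<in> {0..1}" "Im s \<ge> 0" "h \<mu> s = 0"
      by (auto simp: Z_def)
    have "Im s \<noteq> 0"
    proof
      assume "Im s = 0"
      then have "s = of_real (Re s)" by (simp add: complex_eq_iff)
      then show False using real[OF s(1), of "Re s"] s(3) by simp
    qed
    then have "s \<in> U" using s(2) by (simp add: U_def)
    then show "\<mu> \<in> B" using s(1,3) by (auto simp: B_def)
  qed
  ultimately have clB: "closed B"
    using compact_continuous_image[OF continuous_on_fst[OF continuous_on_id], of Z]
    by (simp add: compact_imp_closed)
  have clM: "closed M"
    unfolding closed_sequential_limits
  proof (intro allI impI, elim conjE)
    fix m :: "nat \<Rightarrow> real" and \<mu>
    assume m: "\<forall>n. m n \<in> M" and lim: "m \<longlonglongrightarrow> \<mu>"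
    have m01: "m n \<in> {0..1}" for n using m by (auto simp: M_def)
    have mu01: "\<mu> \<in> {0..1}"
      using lim m01 closed_sequentially[OF closed_atLeastAtMost] by blast
    have "h \<mu> z0 \<noteq> 0" if z0: "z0 \<in> U" for z0
    proof
      assume 0: "h \<mu> z0 = 0"
      have "h \<mu> z0 \<noteq> 0"
      proof (rule Hurwitz_no_zeros[of U "\<lambda>n. h (m n)" "h \<mu>"])
        show "open U" unfolding U_def by (rule open_halfspace_Im_gt)
        have "convex U" unfolding U_def by (rule convex_halfspace_Im_gt)
        then show "connected U" by (rule convex_connected)
        show "h (m n) holomorphic_on U" for n
          using hol[OF m01] holomorphic_on_subset by blast
        show "h \<mu> holomorphic_on U"
          using hol[OF mu01] holomorphic_on_subset by blast
        show "uniform_limit K (\<lambda>n. h (m n)) (h \<mu>) sequentially" if K: "compact K" "K \<subseteq> U" for K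
        proof (rule uniform_limitI)
          fix e :: real assume e: "e > 0"
          have "uniformly_continuous_on ({0..1} \<times> K) (\<lambda>(\<mu>, s). h \<mu> s)"
            by (intro compact_uniformly_continuous continuous_on_subset[OF cont] compact_Times K) auto
          then obtain \<delta> where d: "\<delta> > 0" and
            uc: "\<And>p q. p \<in> {0..1} \<times> K \<Longrightarrow> q \<in> {0..1} \<times> K \<Longrightarrow> dist q p < \<delta> \<Longrightarrow>
              dist (case q of (\<mu>, s) \<Rightarrow> h \<mu> s) (case p of (\<mu>, s) \<Rightarrow> h \<mu> s) < e"
            using e unfolding uniformly_continuous_on_def by metis
          from lim d have "\<forall>\<^sub>F n in sequentially. dist (m n) \<mu> < \<delta>"
            by (simp add: tendstoD)
          then show "\<forall>\<^sub>F n in sequentially. \<forall>x\<in>K. dist (h (m n) x) (h \<mu> x) < e"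
          proof (rule eventually_mono, intro ballI)
            fix n x assume "dist (m n) \<mu> < \<delta>" "x \<in> K"
            then show "dist (h (m n) x) (h \<mu> x) < e"
              using uc[of "(\<mu>, x)" "(m n, x)"] m01[of n] mu01 by (simp add: dist_Pair_Pair)
          qed
        qed
        \<comment> \<open>A constant function vanishing at \<open>z0\<close> would have zeros of norm larger than \<open>R\<close>.\<close>
        show "\<not> h \<mu> constant_on U"
        proof
          assume "h \<mu> constant_on U"
          moreover have z: "Complex 0 (\<bar>R\<bar> + 1) \<in> U" by (simp add: U_def)
          ultimately have "h \<mu> (Complex 0 (\<bar>R\<bar> + 1)) = 0"
            using 0 z0 unfolding constant_on_def by metis
          from bnd[OF mu01 this] show False by (simp add: cmod_def)
        qed
        show "h (m n) z \<noteq> 0" if "z \<in> U" for n z using m that by (auto simp: M_def)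
        show "z0 \<in> U" by fact
      qed
      with 0 show False by simp
    qed
    then show "\<mu> \<in> M" using mu01 by (auto simp: M_def)
  qed
  have "connected {0..1::real}" by simp
  moreover have "M \<inter> B \<inter> {0..1} = {}" "{0..1} \<subseteq> M \<union> B" "0 \<in> M"
    using start by (auto simp: M_def B_def U_def)
  moreover have "M \<inter> {0..1} \<noteq> {}" using \<open>0 \<in> M\<close> by force
  ultimately have "B \<inter> {0..1} = {}"
    using clM clB connected_closedD[of "{0..1::real}" M B] by blast
  then have "1 \<notin> B" by auto
  then have "1 \<in> M" by (simp add: M_def B_def)
  then show ?thesis using s by (auto simp: M_def U_def)
qed

text \<open>
  The homotopy shrinks \<open>u\<close> to \<open>0\<close>. By homogeneity the nonreal zeros \<open>s\<close> of \<open>g 0 s t\<close> satisfy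
  \<open>t / s < 0\<close>, hence lie in the lower half-plane, and the zeros stay bounded because
  \<open>g 0 1 0 \<noteq> 0\<close>.
\<close>
lemma homogeneous_half_plane_step:
  fixes g :: "complex \<Rightarrow> complex \<Rightarrow> complex \<Rightarrow> complex"
  assumes cont: "continuous_on UNIV (\<lambda>(u, s, t). g u s t)"
    and hol: "\<And>u t. (\<lambda>s. g u s t) holomorphic_on UNIV"
    and hom: "\<And>c u s t. g (c * u) (c * s) (c * t) = c ^ d * g u s t"
    and cone: "\<And>r. r \<notin> \<real> \<or> 0 \<le> Re r \<Longrightarrow> g 0 1 r \<noteq> 0"
    and edge: "\<And>\<mu> x. 0 \<le> \<mu> \<Longrightarrow> \<mu> \<le> 1 \<Longrightarrow> g (of_real \<mu> * u) (of_real x) t \<noteq> 0"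
    and t: "Im t > 0" and s: "Im s \<ge> 0"
  shows "g u s t \<noteq> 0"
proof (cases "Im s = 0")
  case True
  then have "s = of_real (Re s)" by (simp add: complex_eq_iff)
  then show ?thesis using edge[of 1 "Re s"] by simp
next
  case False
  with s have s: "Im s > 0" by simp
  have "continuous (at (0, 1, 0)) (\<lambda>(u, s, t). g u s t)"
    using cont by (simp add: continuous_on_eq_continuous_at)
  moreover have "g 0 1 0 \<noteq> 0" using cone by simp
  ultimately have "\<forall>\<^sub>F p in nhds (0, 1, 0). (case p of (u, s, t) \<Rightarrow> g u s t) \<noteq> 0"
    using continuous_at_avoid[of "(0,1,0)" "\<lambda>(u, s, t). g u s t" 0]
    unfolding eventually_nhds_metric by (auto simp: dist_commute)
  then obtain \<delta> where d: "\<delta> > 0" and near: "\<And>p. dist p (0, 1, 0) < \<delta> \<Longrightarrow> (case p of (u, s, t) \<Rightarrow> g u s t) \<noteq> 0"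
    unfolding eventually_nhds_metric by blast
  \<comment> \<open>For \<open>norm s > R\<close> the point \<open>(\<mu> u / s, 1, t / s)\<close> is \<open>\<delta>\<close>-close to \<open>(0, 1, 0)\<close>.\<close>
  define R where "R = (norm u + norm t + 1) / \<delta>"
  have scale: "g u' s' t' = s' ^ d * g (u' / s') 1 (t' / s')" if "s' \<noteq> 0" for u' s' t'
    using hom[of s' "u' / s'" 1 "t' / s'"] that by simp
  have "g (of_real 1 * u) s t \<noteq> 0"
  proof (rule nonvanishing_upper_half_plane_homotopy[where R = R and h = "\<lambda>\<mu> s. g (of_real \<mu> * u) s t"])
    have "continuous_on ({0..1} \<times> UNIV) ((\<lambda>(u, s, t). g u s t) \<circ> (\<lambda>p. (of_real (fst p) * u, snd p, t)))"
      by (intro continuous_on_compose continuous_intros continuous_on_subset[OF cont]) auto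
    then show "continuous_on ({0..1} \<times> UNIV) (\<lambda>(\<mu>, s). g (of_real \<mu> * u) s t)"
      by (simp add: o_def case_prod_unfold)
    show "(\<lambda>s. g (of_real \<mu> * u) s t) holomorphic_on UNIV" for \<mu> by (rule hol)
    show "g (of_real \<mu> * u) (of_real x) t \<noteq> 0" if "\<mu> \<in> {0..1}" for \<mu> x
      using edge that by simp
    show "g (of_real 0 * u) s t \<noteq> 0" if "Im s > 0" for s
    proof -
      have s0: "s \<noteq> 0" using that by auto
      have "t / s \<notin> \<real> \<or> 0 \<le> Re (t / s)"
      proof (rule ccontr)
        assume "\<not> ?thesis"
        then have r: "t / s \<in> \<real>" "Re (t / s) < 0" by auto
        then obtain a where a: "t / s = of_real a" by (auto elim: Reals_cases)
        then have "t = of_real a * s" using s0 by (simp add: field_simps)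
        then have "Im t = a * Im s" by simp
        moreover have "a * Im s < 0" using a r(2) that by (intro mult_neg_pos) auto
        ultimately show False using t by simp
      qed
      then show ?thesis using scale[OF s0, of 0 t] cone s0 by simp
    qed
    show "Im s > 0" by fact
    show "norm s' \<le> R" if mu: "\<mu> \<in> {0..1}" and 0: "g (of_real \<mu> * u) s' t = 0" for \<mu> s'
    proof (rule ccontr)
      assume "\<not> norm s' \<le> R"
      then have sR: "norm s' > R" by simp
      have "R > 0" unfolding R_def using d by (intro divide_pos_pos) (auto intro: add_nonneg_pos)
      then have s0: "s' \<noteq> 0" using sR by auto
      have ns: "norm s' > 0" using s0 by simp
      have "dist (of_real \<mu> * u / s', 1, t / s') (0, 1, 0) = norm (of_real \<mu> * u / s', t / s')"
        by (simp add: dist_Pair_Pair norm_Pair)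
      also have "\<dots> \<le> norm (of_real \<mu> * u / s') + norm (t / s')"
        by (rule norm_Pair_le)
      also have "\<dots> = (\<bar>\<mu>\<bar> * norm u + norm t) / norm s'"
        by (simp add: norm_divide norm_mult add_divide_distrib)
      also have "\<dots> \<le> (norm u + norm t) / norm s'"
        using mu by (intro divide_right_mono add_mono mult_left_le_one_le) auto
      also have "\<dots> < \<delta>"
      proof -
        have "norm u + norm t + 1 = R * \<delta>" using d by (simp add: R_def)
        also have "\<dots> < norm s' * \<delta>" using sR d by simp
        finally show ?thesis using ns by (simp add: field_simps)
      qed
      finally have "g (of_real \<mu> * u / s') 1 (t / s') \<noteq> 0" using near by fastforce
      then show False using 0 scale[OF s0] s0 by simp
    qed
  qed
  then show ?thesis by simp
qed

text \<open>
  The points \<open>(1, 0, 0)\<close> and \<open>(0, 1, 0)\<close> belong to the hyperbolicity cone by \<open>cone_u\<close> and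
  \<open>cone_s\<close>. For real \<open>s\<close>, hyperbolicity is the edge condition that lets the preceding lemma move
  \<open>u\<close> into the upper half-plane. Its outcome is in turn the edge condition for moving \<open>s\<close> while
  \<open>u\<close> is any point there.
\<close>
theorem hyperbolic_imp_stable:
  fixes g :: "complex \<Rightarrow> complex \<Rightarrow> complex \<Rightarrow> complex"
  assumes cont: "continuous_on UNIV (\<lambda>(u, s, t). g u s t)"
    and hol_u: "\<And>s t. (\<lambda>u. g u s t) holomorphic_on UNIV"
    and hol_s: "\<And>u t. (\<lambda>s. g u s t) holomorphic_on UNIV"
    and hom: "\<And>c u s t. g (c * u) (c * s) (c * t) = c ^ d * g u s t"
    and hyp: "\<And>u s t. u \<in> \<real> \<Longrightarrow> s \<in> \<real> \<Longrightarrow> t \<notin> \<real> \<Longrightarrow> g u s t \<noteq> 0"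
    and cone_u: "\<And>r. 0 \<le> r \<Longrightarrow> g 1 0 (of_real r) \<noteq> 0"
    and cone_s: "\<And>r. 0 \<le> r \<Longrightarrow> g 0 1 (of_real r) \<noteq> 0"
    and "Im u \<ge> 0" "Im s \<ge> 0" "Im t > 0"
  shows "g u s t \<noteq> 0"
proof -
  have tR: "t \<notin> \<real>" using \<open>Im t > 0\<close> by (auto simp: complex_is_Real_iff)
  have cone_u': "g 1 0 r \<noteq> 0" if "r \<notin> \<real> \<or> 0 \<le> Re r" for r
    using that hyp[of 1 0 r] cone_u[of "Re r"] by (cases "r \<in> \<real>") auto
  have cone_s': "g 0 1 r \<noteq> 0" if "r \<notin> \<real> \<or> 0 \<le> Re r" for r
    using that hyp[of 0 1 r] cone_s[of "Re r"] by (cases "r \<in> \<real>") auto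
  have cont': "continuous_on UNIV (\<lambda>(s, u, t). g u s t)"
  proof -
    have "continuous_on UNIV ((\<lambda>(u, s, t). g u s t) \<circ> (\<lambda>p. (fst (snd p), fst p, snd (snd p))))"
      by (intro continuous_on_compose continuous_intros continuous_on_subset[OF cont]) auto
    then show ?thesis by (simp add: o_def case_prod_unfold)
  qed
  have u_side: "g u' (of_real x) t \<noteq> 0" if "Im u' \<ge> 0" for u' x
    using homogeneous_half_plane_step[of "\<lambda>s u t. g u s t" d "of_real x" t u',
        OF cont' hol_u hom cone_u' _ \<open>Im t > 0\<close> that] hyp tR
    by simp
  show ?thesis
    by (rule homogeneous_half_plane_step[of g d u t s, OF cont hol_s hom cone_s' _ \<open>Im t > 0\<close> \<open>Im s \<ge> 0\<close>])
      (use u_side \<open>Im u \<ge> 0\<close> in auto)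
qed

text \<open>
  Since \<open>(\<i>u, \<i>s, \<i>t)\<close> lies in the region of stability, homogeneity excludes zeros at
  \<open>(u, s, t)\<close>. The sign is then constant on the segment from \<open>(0, 0, 1)\<close>.
\<close>
corollary hyperbolic_cone_positive:
  fixes g :: "complex \<Rightarrow> complex \<Rightarrow> complex \<Rightarrow> complex"
    and G :: "real \<Rightarrow> real \<Rightarrow> real \<Rightarrow> real"
  assumes cont: "continuous_on UNIV (\<lambda>(u, s, t). g u s t)"
    and hol_u: "\<And>s t. (\<lambda>u. g u s t) holomorphic_on UNIV"
    and hol_s: "\<And>u t. (\<lambda>s. g u s t) holomorphic_on UNIV"
    and hom: "\<And>c u s t. g (c * u) (c * s) (c * t) = c ^ d * g u s t"
    and hyp: "\<And>u s t. u \<in> \<real> \<Longrightarrow> s \<in> \<real> \<Longrightarrow> t \<notin> \<real> \<Longrightarrow> g u s t \<noteq> 0"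
    and cone_u: "\<And>r. 0 \<le> r \<Longrightarrow> g 1 0 (of_real r) \<noteq> 0"
    and cone_s: "\<And>r. 0 \<le> r \<Longrightarrow> g 0 1 (of_real r) \<noteq> 0"
    and G: "\<And>u s t. g (of_real u) (of_real s) (of_real t) = of_real (G u s t)"
    and e: "G 0 0 1 > 0"
    and "u \<ge> 0" "s \<ge> 0" "t > 0"
  shows "G u s t > 0"
proof -
  have nz: "G u s t \<noteq> 0" if "u \<ge> 0" "s \<ge> 0" "t > 0" for u s t
  proof
    assume "G u s t = 0"
    then have "g (\<i> * of_real u) (\<i> * of_real s) (\<i> * of_real t) = 0"
      by (simp add: hom G)
    moreover have "g (\<i> * of_real u) (\<i> * of_real s) (\<i> * of_real t) \<noteq> 0"
      by (rule hyperbolic_imp_stable[OF cont hol_u hol_s hom hyp cone_u cone_s]) (use that in auto)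
    ultimately show False by simp
  qed
  define p where "p = (\<lambda>\<tau>. G (\<tau> * u) (\<tau> * s) (\<tau> * t + (1 - \<tau>)))"
  have "continuous_on UNIV ((\<lambda>(u, s, t). g u s t) \<circ>
      (\<lambda>\<tau>. (of_real (\<tau> * u), of_real (\<tau> * s), of_real (\<tau> * t + (1 - \<tau>)))))"
    by (intro continuous_on_compose continuous_intros continuous_on_subset[OF cont]) auto
  then have "continuous_on UNIV (\<lambda>\<tau>. Re (g (of_real (\<tau> * u)) (of_real (\<tau> * s)) (of_real (\<tau> * t + (1 - \<tau>)))))"
    unfolding o_def by (intro continuous_on_Re) simp
  then have contp: "continuous_on {0..1} p"
    unfolding p_def G by (auto intro: continuous_on_subset)
  have pnz: "p \<tau> \<noteq> 0" if "\<tau> \<in> {0..1}" for \<tau>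
  proof -
    have "\<tau> * t + (1 - \<tau>) > 0"
      using that \<open>t > 0\<close> by (cases "\<tau> = 1") (auto intro: add_nonneg_pos)
    then show ?thesis unfolding p_def using that \<open>u \<ge> 0\<close> \<open>s \<ge> 0\<close> by (intro nz) auto
  qed
  show ?thesis
  proof (rule ccontr)
    assume "\<not> ?thesis"
    then have "p 1 \<le> 0" "p 0 \<ge> 0" using e by (auto simp: p_def)
    then obtain \<tau> where "\<tau> \<in> {0..1}" "p \<tau> = 0"
      using IVT2'[of p 1 0 0] contp by auto
    with pnz show False by blast
  qed
qed

section \<open>Elementary symmetric functions as coefficients\<close>

text \<open>The real function \<open>elem_sym\<close>, over rings that include the complex numbers.\<close>
definition esym :: "'i set \<Rightarrow> nat \<Rightarrow> ('i \<Rightarrow> 'a::comm_ring_1) \<Rightarrow> 'a" where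
  "esym I m x = (\<Sum>J | J \<subseteq> I \<and> card J = m. \<Prod>i\<in>J. x i)"

lemma elem_sym_eq_esym: "elem_sym I m x = esym I m x"
  by (simp add: elem_sym_def esym_def)

lemma esym_0 [simp]: "finite I \<Longrightarrow> esym I 0 x = 1"
proof -
  assume "finite I"
  then have "{J. J \<subseteq> I \<and> card J = 0} = {{}}"
    by (auto dest: finite_subset)
  then show ?thesis by (simp add: esym_def)
qed

lemma esym_insert:
  assumes "finite I" "i \<notin> I"
  shows "esym (insert i I) (Suc m) x = esym I (Suc m) x + x i * esym I m x"
proof -
  have split: "{J. J \<subseteq> insert i I \<and> card J = Suc m} =
      {J. J \<subseteq> I \<and> card J = Suc m} \<union> insert i ` {J. J \<subseteq> I \<and> card J = m}" (is "?L = ?A \<union> ?B")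
  proof (intro equalityI subsetI)
    fix J assume J: "J \<in> ?L"
    show "J \<in> ?A \<union> ?B"
    proof (cases "i \<in> J")
      case True
      then have "J = insert i (J - {i})" by auto
      moreover have "J - {i} \<in> {J. J \<subseteq> I \<and> card J = m}" using J True by auto
      ultimately show ?thesis by blast
    qed (use J in auto)
  next
    fix J assume J: "J \<in> ?A \<union> ?B"
    moreover have "card (insert i K) = Suc (card K)" if "K \<subseteq> I" for K
      using that assms by (meson card_insert_disjoint finite_subset subsetD)
    ultimately show "J \<in> ?L" by auto
  qed
  have "inj_on (insert i) {J. J \<subseteq> I \<and> card J = m}"
    using assms(2) by (auto simp: inj_on_def insert_ident)
  moreover have "(\<Prod>j\<in>insert i J. x j) = x i * (\<Prod>j\<in>J. x j)" if "J \<subseteq> I" for J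
    using that assms by (meson finite_subset prod.insert subsetD)
  ultimately have "(\<Sum>J\<in>?B. \<Prod>j\<in>J. x j) = x i * esym I m x"
    by (simp add: sum.reindex esym_def sum_distrib_left)
  moreover have "?A \<inter> ?B = {}" using assms by auto
  ultimately show ?thesis
    using assms unfolding esym_def split by (subst sum.union_disjoint) (auto simp: esym_def)
qed

lemma esym_scale: "esym I m (\<lambda>i. a * x i) = a ^ m * esym I m x"
  by (auto simp: esym_def sum_distrib_left prod.distrib intro!: sum.cong)

lemma esym_of_real:
  "esym I m (\<lambda>i. of_real (x i) :: 'a::{comm_ring_1, real_algebra_1}) = of_real (esym I m x)"
  by (simp add: esym_def)

lemma continuous_on_esym [continuous_intros]:
  fixes x :: "'b::topological_space \<Rightarrow> 'i \<Rightarrow> 'a::real_normed_field"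
  assumes "\<And>i. i \<in> I \<Longrightarrow> continuous_on S (\<lambda>p. x p i)"
  shows "continuous_on S (\<lambda>p. esym I m (x p))"
  unfolding esym_def by (intro continuous_intros assms) auto

lemma holomorphic_on_esym:
  assumes "\<And>i. i \<in> I \<Longrightarrow> (\<lambda>z. x z i) holomorphic_on S"
  shows "(\<lambda>z. esym I m (x z)) holomorphic_on S"
  unfolding esym_def by (intro holomorphic_intros assms) auto

definition linprod :: "('n::finite \<Rightarrow> 'a) \<Rightarrow> 'a::field_char_0 poly" where
  "linprod x = (\<Prod>i\<in>UNIV. [:x i, 1:])"

lemma coeff_linprod:
  fixes x :: "'n::finite \<Rightarrow> 'a::field_char_0"
  assumes "m \<le> CARD('n)"
  shows "coeff (linprod x) (CARD('n) - m) = esym UNIV m x"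
proof -
  have X: "card X \<le> CARD('n)" for X :: "'n set" by (simp add: card_mono)
  have lin: "[:x i, 1:] = [:x i:] + monom 1 1" for i
    by (simp add: monom_altdef)
  have "linprod x = (\<Sum>X\<in>Pow UNIV. (\<Prod>i\<in>X. [:x i:]) * (\<Prod>i\<in>UNIV - X. monom 1 1))"
    unfolding linprod_def lin by (rule prod_add) simp
  also have "\<dots> = (\<Sum>X\<in>UNIV. monom (\<Prod>i\<in>X. x i) (CARD('n) - card X))"
  proof (intro sum.cong)
    fix X :: "'n set"
    have "(\<Prod>i\<in>X. [:x i:]) = [:\<Prod>i\<in>X. x i:]"
      by (induction X rule: infinite_finite_induct) (simp_all add: one_pCons mult.commute)
    moreover have "(\<Prod>i\<in>UNIV - X. monom (1::'a) 1) = monom 1 (CARD('n) - card X)"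
      by (simp add: monom_altdef card_Diff_subset)
    ultimately show "(\<Prod>i\<in>X. [:x i:]) * (\<Prod>i\<in>UNIV - X. monom 1 1) = monom (\<Prod>i\<in>X. x i) (CARD('n) - card X)"
      by (simp add: smult_monom)
  qed simp
  moreover have "CARD('n) - card X = CARD('n) - m \<longleftrightarrow> card X = m" for X :: "'n set"
    using X[of X] assms by linarith
  ultimately have "coeff (linprod x) (CARD('n) - m) =
      (\<Sum>X\<in>UNIV. if card X = m then \<Prod>i\<in>X. x i else 0)"
    by (simp add: coeff_sum)
  then show ?thesis by (simp add: esym_def sum.inter_filter[symmetric])
qed

lemma degree_linprod: "degree (linprod (x :: 'n::finite \<Rightarrow> 'a::field_char_0)) = CARD('n)"
  by (simp add: linprod_def degree_prod_eq_sum_degree)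

lemma higher_pderiv_shift:
  "(pderiv ^^ m) (pcompose p [:t, 1:]) = pcompose ((pderiv ^^ m) p) [:t, 1:]"
  for p :: "'a::field_char_0 poly"
  by (induction m) (simp_all add: pderiv_pcompose pderiv_pCons)

lemma linprod_shift: "linprod (\<lambda>i. x i + t) = pcompose (linprod x) [:t, 1:]"
  by (simp add: linprod_def pcompose_prod pcompose_pCons add.commute)

lemma poly_higher_pderiv_linprod:
  fixes x :: "'n::finite \<Rightarrow> 'a::field_char_0"
  assumes "m \<le> CARD('n)"
  shows "poly ((pderiv ^^ (CARD('n) - m)) (linprod x)) t = fact (CARD('n) - m) * esym UNIV m (\<lambda>i. x i + t)"
proof -
  have "poly ((pderiv ^^ (CARD('n) - m)) (linprod x)) t =
      poly ((pderiv ^^ (CARD('n) - m)) (linprod (\<lambda>i. x i + t))) 0"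
    by (simp add: linprod_shift higher_pderiv_shift poly_pcompose)
  also have "\<dots> = fact (CARD('n) - m) * coeff (linprod (\<lambda>i. x i + t)) (CARD('n) - m)"
    by (simp add: poly_0_coeff_0 coeff_higher_pderiv pochhammer_fact)
  finally show ?thesis using coeff_linprod[OF assms] by simp
qed

text \<open>
  The Garding cone absorbs translations by nonnegative multiples of \<open>e\<close>: as a polynomial in \<open>t\<close>,
  \<open>\<sigma>\<^sub>m(x + t e)\<close> has positive multiples of the \<open>\<sigma>\<^sub>j(x)\<close> with \<open>j \<le> m\<close> as coefficients.
\<close>
lemma esym_shift_pos:
  fixes x :: "'n::finite \<Rightarrow> real"
  assumes "m \<le> CARD('n)" and pos: "\<And>j. 1 \<le> j \<Longrightarrow> j \<le> m \<Longrightarrow> esym UNIV j x > 0" and "t \<ge> 0"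
  shows "esym UNIV m (\<lambda>i. x i + t) > 0"
proof -
  define p where "p = (pderiv ^^ (CARD('n) - m)) (linprod x)"
  have pos': "esym UNIV j x > 0" if "j \<le> m" for j
    using pos[of j] that by (cases "j = 0") auto
  have deg: "degree p = m"
    using assms(1) by (simp add: p_def degree_higher_pderiv degree_linprod)
  have c: "coeff p j > 0" if "j \<le> m" for j
  proof -
    have "j + (CARD('n) - m) = CARD('n) - (m - j)" using that assms(1) by simp
    then have "coeff p j = pochhammer (of_nat (Suc j)) (CARD('n) - m) * esym UNIV (m - j) x"
      using coeff_linprod[of "m - j" x] assms(1)
      by (simp add: p_def coeff_higher_pderiv)
    then show ?thesis using pos'[of "m - j"] by (simp add: pochhammer_pos)
  qed
  have "0 < coeff p 0 * t ^ 0" using c by simp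
  also have "\<dots> \<le> (\<Sum>j\<le>m. coeff p j * t ^ j)"
    by (rule member_le_sum) (use c \<open>t \<ge> 0\<close> in \<open>auto intro!: mult_nonneg_nonneg simp: less_imp_le\<close>)
  also have "\<dots> = poly p t" by (simp add: poly_altdef deg)
  finally show ?thesis
    using poly_higher_pderiv_linprod[OF assms(1), of x t] by (simp add: p_def zero_less_mult_iff)
qed

section \<open>Operators that preserve real-rootedness\<close>

definition real_rooted :: "complex poly \<Rightarrow> bool" where
  "real_rooted p \<longleftrightarrow> (\<forall>z. z \<notin> \<real> \<longrightarrow> poly p z \<noteq> 0)"

text \<open>
  This identity serves twice: off the real axis, to show that \<open>p'/p\<close> is not real when all the
  roots are, and to the right of all roots, to show that \<open>p'/p\<close> decreases.
\<close>
lemma log_derivative: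
  fixes p :: "complex poly"
  assumes "p \<noteq> 0"
  obtains A where "size A = degree p" "\<And>r. r \<in># A \<Longrightarrow> poly p r = 0"
    "\<And>z. poly p z \<noteq> 0 \<Longrightarrow> poly (pderiv p) z = poly p z * (\<Sum>r\<in>#A. 1 / (z - r))"
proof -
  obtain A where A: "size A = degree p" and p: "p = smult (lead_coeff p) (\<Prod>x\<in>#A. [:-x, 1:])"
    using alg_closed_imp_factorization[OF assms] by blast
  have root: "poly (\<Prod>x\<in>#A. [:-x, 1:]) r = 0" if "r \<in># A" for r and A :: "complex multiset"
    using that by (induction A) auto
  have der: "poly (pderiv (\<Prod>x\<in>#A. [:-x, 1:])) z = poly (\<Prod>x\<in>#A. [:-x, 1:]) z * (\<Sum>r\<in>#A. 1 / (z - r))"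
    if "z \<notin># A" for z and A :: "complex multiset"
    using that
  proof (induction A)
    case (add a A)
    then have "z - a \<noteq> 0" "z \<notin># A" by auto
    define q where "q = (\<Prod>x\<in>#A. [:-x, 1:])"
    have q: "(\<Prod>x\<in>#add_mset a A. [:-x, 1:]) = [:-a, 1:] * q" by (simp add: q_def)
    have "poly (pderiv ([:-a, 1:] * q)) z = poly q z + (z - a) * poly (pderiv q) z"
      by (simp only: pderiv_mult) (simp add: pderiv_pCons algebra_simps)
    also have "\<dots> = (z - a) * poly q z * (1 / (z - a) + (\<Sum>r\<in>#A. 1 / (z - r)))"
      using add.IH[OF \<open>z \<notin># A\<close>] \<open>z - a \<noteq> 0\<close> by (simp add: q_def field_simps)
    also have "(z - a) * poly q z = poly ([:-a, 1:] * q) z" by (simp add: algebra_simps)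
    finally show ?case unfolding q by simp
  qed simp
  show thesis
  proof
    show "poly p r = 0" if "r \<in># A" for r
      by (subst p) (simp add: root that)
    then have "z \<notin># A" if "poly p z \<noteq> 0" for z using that by blast
    then show "poly (pderiv p) z = poly p z * (\<Sum>r\<in>#A. 1 / (z - r))" if "poly p z \<noteq> 0" for z
      using der[of z A] that by (subst p, subst (2) p) (simp add: pderiv_smult)
  qed (fact A)
qed

text \<open>For real \<open>r\<close>, the number \<open>1 / (z - r)\<close> lies in the half-plane opposite to that of \<open>z\<close>.\<close>
lemma Im_sum_inverse_neg:
  assumes "A \<noteq> {#}" "\<And>r. r \<in># A \<Longrightarrow> r \<in> \<real>" "z \<notin> \<real>"
  shows "Im (\<Sum>r\<in>#A. 1 / (z - r)) * Im z < 0"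
proof -
  have one: "Im (1 / (z - r)) * Im z < 0" if "r \<in> \<real>" for r
  proof -
    have "Im z \<noteq> 0" "Im r = 0" using assms(3) that by (auto simp: complex_is_Real_iff)
    then have "Im z * Im z > 0" "(Re (z - r))\<^sup>2 + (Im (z - r))\<^sup>2 > 0"
      by (auto simp: not_sum_squares_lt_zero sum_power2_gt_zero_iff zero_less_mult_iff linorder_neq_iff)
    moreover have "Im (1 / (z - r)) * Im z = - (Im z * Im z) / ((Re (z - r))\<^sup>2 + (Im (z - r))\<^sup>2)"
      using \<open>Im r = 0\<close> by (simp add: Im_divide)
    ultimately show ?thesis by (simp add: divide_neg_pos)
  qed
  show ?thesis using assms(1,2)
  proof (induction A)
    case (add a A)
    then show ?case using one[of a]
      by (cases "A = {#}") (auto simp: distrib_right intro: add_neg_neg)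
  qed simp
qed

lemma real_rooted_log_derivative:
  assumes "real_rooted p" "degree p \<ge> 1" "z \<notin> \<real>"
  obtains w where "w \<notin> \<real>" "poly (pderiv p) z = poly p z * w"
proof -
  have "p \<noteq> 0" using assms(2) by auto
  then obtain A where A: "size A = degree p" "\<And>r. r \<in># A \<Longrightarrow> poly p r = 0"
    "\<And>z. poly p z \<noteq> 0 \<Longrightarrow> poly (pderiv p) z = poly p z * (\<Sum>r\<in>#A. 1 / (z - r))"
    using log_derivative by blast
  have "Im (\<Sum>r\<in>#A. 1 / (z - r)) * Im z < 0"
    using A(1,2) assms by (intro Im_sum_inverse_neg) (auto simp: real_rooted_def)
  then have "(\<Sum>r\<in>#A. 1 / (z - r)) \<notin> \<real>" by (auto simp: complex_is_Real_iff)
  then show thesis using that A(3)[of z] assms by (auto simp: real_rooted_def)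
qed

lemma real_rooted_pderiv:
  assumes "real_rooted p" "degree p \<ge> 1"
  shows "real_rooted (pderiv p)"
  unfolding real_rooted_def
proof (intro allI impI)
  fix z :: complex assume z: "z \<notin> \<real>"
  obtain w where w: "w \<notin> \<real>" "poly (pderiv p) z = poly p z * w"
    using real_rooted_log_derivative[OF assms z] .
  then have "w \<noteq> 0" by auto
  then show "poly (pderiv p) z \<noteq> 0"
    using assms(1) z w(2) by (simp add: real_rooted_def)
qed

lemma real_rooted_higher_pderiv:
  assumes "real_rooted p" "m \<le> degree p"
  shows "real_rooted ((pderiv ^^ m) p)"
  using assms(2)
  by (induction m) (auto intro!: real_rooted_pderiv assms simp: degree_higher_pderiv)

text \<open>
  Off the reals \<open>p + c p' = p (1 + c p'/p)\<close>, and \<open>p'/p\<close> differs from the real number \<open>-1/c\<close>.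
\<close>
lemma real_rooted_add_pderiv:
  assumes "real_rooted p" "c \<in> \<real>"
  shows "real_rooted (p + smult c (pderiv p))"
proof (cases "degree p = 0 \<or> c = 0")
  case True
  then have "p + smult c (pderiv p) = p" by (auto simp: pderiv_eq_0_iff[THEN iffD2])
  then show ?thesis using assms(1) by metis
next
  case False
  show ?thesis unfolding real_rooted_def
  proof (intro allI impI)
    fix z :: complex assume z: "z \<notin> \<real>"
    obtain w where w: "w \<notin> \<real>" "poly (pderiv p) z = poly p z * w"
      using real_rooted_log_derivative[OF assms(1) _ z] False by auto
    have "1 + c * w \<noteq> 0"
    proof
      assume "1 + c * w = 0"
      then have "w = - (1 / c)" using False by (simp add: field_simps eq_neg_iff_add_eq_0)
      then show False using w(1) assms(2) by simp
    qed
    moreover have "poly (p + smult c (pderiv p)) z = poly p z * (1 + c * w)"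
      using w(2) by (simp add: algebra_simps)
    ultimately show "poly (p + smult c (pderiv p)) z \<noteq> 0"
      using assms(1) z by (simp add: real_rooted_def)
  qed
qed

text \<open>
  On polynomials of degree at most \<open>l\<close> this is the product of the commuting operators
  \<open>1 + c\<^sub>i d/dt\<close>, written in expanded form; \<open>esym_op_insert\<close> recovers the factors one by one.
\<close>
definition esym_op :: "nat \<Rightarrow> 'i set \<Rightarrow> ('i \<Rightarrow> 'a) \<Rightarrow> 'a::field_char_0 poly \<Rightarrow> 'a poly" where
  "esym_op l I c q = (\<Sum>m\<le>l. smult (esym I m c) ((pderiv ^^ m) q))"

lemma higher_pderiv_eq_0: "degree q < m \<Longrightarrow> (pderiv ^^ m) q = 0"
  for q :: "'a::field_char_0 poly"
proof (induction m)
  case (Suc m)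
  have "degree ((pderiv ^^ m) q) = 0" using Suc.prems by (simp add: degree_higher_pderiv)
  then show ?case by (simp add: pderiv_eq_0_iff)
qed simp

lemma pderiv_esym_op:
  assumes "degree q \<le> Suc l"
  shows "pderiv (esym_op (Suc l) I c q) = esym_op l I c (pderiv q)"
proof -
  have "pderiv (esym_op (Suc l) I c q) = (\<Sum>m\<le>Suc l. smult (esym I m c) ((pderiv ^^ Suc m) q))"
    by (simp only: esym_op_def higher_pderiv_sum[of 1, simplified] pderiv_smult funpow.simps o_apply)
  also have "\<dots> = (\<Sum>m\<le>l. smult (esym I m c) ((pderiv ^^ Suc m) q))"
    using higher_pderiv_eq_0[of q "Suc (Suc l)"] assms by simp
  finally show ?thesis by (simp add: esym_op_def funpow_Suc_right del: funpow.simps)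
qed

lemma smult_sum_right: "smult a (sum f A) = (\<Sum>i\<in>A. smult a (f i))"
  by (induction A rule: infinite_finite_induct) (simp_all add: smult_add_right)

lemma esym_op_insert:
  assumes "finite I" "i \<notin> I" "degree q \<le> l"
  shows "esym_op l (insert i I) c q = esym_op l I c q + smult (c i) (pderiv (esym_op l I c q))"
proof (cases l)
  case 0
  then have "pderiv q = 0" using assms(3) by (simp add: pderiv_eq_0_iff)
  then show ?thesis using 0 assms by (simp add: esym_op_def)
next
  case (Suc k)
  have "esym_op l (insert i I) c q = q + (\<Sum>m\<le>k. smult (esym (insert i I) (Suc m) c) ((pderiv ^^ Suc m) q))"
    unfolding esym_op_def Suc using assms by (subst sum.atMost_Suc_shift) simp
  also have "\<dots> = q + (\<Sum>m\<le>k. smult (esym I (Suc m) c) ((pderiv ^^ Suc m) q))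
      + smult (c i) (\<Sum>m\<le>k. smult (esym I m c) ((pderiv ^^ Suc m) q))"
    using assms(1,2)
    by (simp add: esym_insert smult_add_left sum.distrib smult_sum_right add.assoc del: funpow.simps)
  also have "q + (\<Sum>m\<le>k. smult (esym I (Suc m) c) ((pderiv ^^ Suc m) q)) = esym_op l I c q"
    unfolding esym_op_def Suc using assms by (subst sum.atMost_Suc_shift) simp
  also have "(\<Sum>m\<le>k. smult (esym I m c) ((pderiv ^^ Suc m) q)) = pderiv (esym_op l I c q)"
    using assms(3) unfolding Suc
    by (subst pderiv_esym_op) (simp_all add: esym_op_def funpow_Suc_right del: funpow.simps)
  finally show ?thesis .
qed

lemma real_rooted_esym_op:
  assumes "finite I" "\<And>i. i \<in> I \<Longrightarrow> c i \<in> \<real>" "degree q \<le> l" "real_rooted q"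
  shows "real_rooted (esym_op l I c q)"
  using assms(1,2)
proof (induction I)
  case empty
  have "esym {} m c = 0" if "m \<noteq> 0" for m
    using that by (auto simp: esym_def)
  then have "esym_op l {} c q = (\<Sum>m\<le>l. if m = 0 then q else 0)"
    unfolding esym_op_def by (intro sum.cong) auto
  then show ?case using assms(4) by simp
next
  case (insert i I)
  then show ?case using assms(3) by (simp add: esym_op_insert real_rooted_add_pderiv)
qed

lemma real_rooted_linprod:
  assumes "\<And>i. x i \<in> \<real>"
  shows "real_rooted (linprod x)"
  unfolding real_rooted_def
proof (intro allI impI)
  fix z :: complex assume "z \<notin> \<real>"
  then have "x i + z \<noteq> 0" for i
    using assms by (metis Reals_minus add_eq_0_iff)
  then show "poly (linprod x) z \<noteq> 0"
    by (simp add: linprod_def poly_prod)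
qed

section \<open>The symmetric functions \<open>W\<^sub>l\<close> and their hyperbolicity\<close>

text \<open>
  This is \<open>(n - l)! (\<Prod>i\<in>I. 1 + c\<^sub>i D) \<sigma>\<^sub>l\<close> for \<open>n = CARD('n)\<close> and \<open>l \<le> n\<close>. The factor
  \<open>(n - l)!\<close> is there to make \<open>D\<close> lower the index \<open>l\<close> without a constant
  (\<open>poly_pderiv_dsym\<close>).
\<close>
definition dsym :: "'i set \<Rightarrow> nat \<Rightarrow> ('i \<Rightarrow> 'a) \<Rightarrow> ('n::finite \<Rightarrow> 'a) \<Rightarrow> 'a::real_normed_field" where
  "dsym I l c x = (\<Sum>m\<le>l. fact (CARD('n) - l + m) * esym I m c * esym UNIV (l - m) x)"

lemma dsym_scale: "dsym I l (\<lambda>i. a * c i) (\<lambda>j. a * x j) = a ^ l * dsym I l c x"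
  unfolding dsym_def sum_distrib_left
proof (intro sum.cong refl)
  fix m assume "m \<in> {..l}"
  then have "a ^ m * a ^ (l - m) = a ^ l" by (simp flip: power_add)
  then show "fact (CARD('n) - l + m) * esym I m (\<lambda>i. a * c i) * esym UNIV (l - m) (\<lambda>j. a * x j) =
      a ^ l * (fact (CARD('n) - l + m) * esym I m c * esym UNIV (l - m) x)" for x :: "'n::finite \<Rightarrow> 'a"
    by (simp add: esym_scale mult_ac)
qed

lemma dsym_of_real:
  "dsym I l (\<lambda>i. of_real (c i)) (\<lambda>j. of_real (x j)) = of_real (dsym I l c x)"
  by (simp add: dsym_def esym_of_real)

lemma esym_zero: "finite I \<Longrightarrow> esym I m (\<lambda>_. 0) = (if m = 0 then 1 else 0)"
  by (cases m) (auto simp: esym_def[of _ "Suc _"] intro!: sum.neutral)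

lemma dsym_zero:
  fixes x :: "'n::finite \<Rightarrow> 'a::real_normed_field"
  assumes "finite I"
  shows "dsym I l (\<lambda>_. 0) x = fact (CARD('n) - l) * esym UNIV l x"
proof -
  have "dsym I l (\<lambda>_. 0) x = (\<Sum>m\<le>l. if m = 0 then fact (CARD('n) - l) * esym UNIV l x else 0)"
    unfolding dsym_def using assms by (intro sum.cong) (auto simp: esym_zero)
  then show ?thesis by simp
qed

text \<open>
  The \<open>(n - l)\<close>-th derivative of \<open>\<Prod>j. x\<^sub>j + t\<close> at \<open>t\<close> is \<open>(n - l)! \<sigma>\<^sub>l(x + t e)\<close>. Real-rootedness on
  lines parallel to \<open>e\<close> is thereby a matter of polynomials in one variable.
\<close>
lemma dsym_eq_poly:
  fixes x :: "'n::finite \<Rightarrow> 'a::real_normed_field"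
  assumes "l \<le> CARD('n)"
  shows "dsym I l c (\<lambda>i. x i + t) = poly (esym_op l I c ((pderiv ^^ (CARD('n) - l)) (linprod x))) t"
proof -
  have "poly ((pderiv ^^ m) ((pderiv ^^ (CARD('n) - l)) (linprod x))) t =
      fact (CARD('n) - l + m) * esym UNIV (l - m) (\<lambda>i. x i + t)" if "m \<le> l" for m
  proof -
    have "m + (CARD('n) - l) = CARD('n) - (l - m)" using that assms by simp
    then have "(pderiv ^^ m) ((pderiv ^^ (CARD('n) - l)) (linprod x)) = (pderiv ^^ (CARD('n) - (l - m))) (linprod x)"
      by (metis comp_apply funpow_add)
    moreover have "CARD('n) - (l - m) = CARD('n) - l + m" using that assms by simp
    ultimately show ?thesis
      using poly_higher_pderiv_linprod[of "l - m" x t] assms by simp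
  qed
  then show ?thesis by (simp add: esym_op_def dsym_def poly_sum mult_ac)
qed

lemma poly_pderiv_dsym:
  fixes x :: "'n::finite \<Rightarrow> 'a::real_normed_field"
  assumes "Suc l \<le> CARD('n)"
  shows "poly (pderiv (esym_op (Suc l) I c ((pderiv ^^ (CARD('n) - Suc l)) (linprod x)))) t =
    dsym I l c (\<lambda>i. x i + t)"
proof -
  have "pderiv ((pderiv ^^ (CARD('n) - Suc l)) (linprod x)) = (pderiv ^^ (CARD('n) - l)) (linprod x)"
    using assms by (simp flip: funpow.simps(2)[THEN fun_cong, unfolded o_apply] add: Suc_diff_Suc)
  then show ?thesis
    using assms by (subst pderiv_esym_op) (simp_all add: degree_higher_pderiv degree_linprod dsym_eq_poly)
qed

lemma real_rooted_dsym_poly: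
  fixes x :: "'n::finite \<Rightarrow> complex"
  assumes "finite I" "l \<le> CARD('n)" "\<And>i. i \<in> I \<Longrightarrow> c i \<in> \<real>" "\<And>j. x j \<in> \<real>"
  shows "real_rooted (esym_op l I c ((pderiv ^^ (CARD('n) - l)) (linprod x)))"
  using assms
  by (intro real_rooted_esym_op real_rooted_higher_pderiv real_rooted_linprod)
    (auto simp: degree_higher_pderiv degree_linprod)

lemma dsym_hyperbolic:
  fixes x :: "'n::finite \<Rightarrow> complex"
  assumes "finite I" "Suc l \<le> CARD('n)" "\<And>i. i \<in> I \<Longrightarrow> c i \<in> \<real>" "\<And>j. x j \<in> \<real>" "y \<in> \<real>" "t \<notin> \<real>"
  shows "dsym I (Suc l) c (\<lambda>i. x i + t) - y * dsym I l c (\<lambda>i. x i + t) \<noteq> 0"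
proof -
  define p where "p = esym_op (Suc l) I c ((pderiv ^^ (CARD('n) - Suc l)) (linprod x))"
  have "real_rooted (p + smult (- y) (pderiv p))"
    unfolding p_def using assms by (intro real_rooted_add_pderiv real_rooted_dsym_poly) auto
  then have "poly (p + smult (- y) (pderiv p)) t \<noteq> 0"
    using assms(6) by (simp add: real_rooted_def)
  then show ?thesis
    using assms(2) by (simp add: dsym_eq_poly[OF assms(2)] poly_pderiv_dsym[OF assms(2), symmetric] p_def)
qed

text \<open>
  A point strictly below the graph of the quotient stays below it along the ray in the direction
  \<open>e\<close>, that is, it lies in the hyperbolicity cone. On this ray the quotient is \<open>F / F'\<close> for a
  real-rooted \<open>F\<close>. Positivity puts all roots to the left of the ray, where \<open>F'/F\<close> is a sum of
  decreasing terms \<open>1 / (t - r)\<close>.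
\<close>
lemma dsym_ratio_along_ray:
  fixes x :: "'n::finite \<Rightarrow> real"
  assumes "finite I" "Suc l \<le> CARD('n)"
    and pos: "\<And>r. 0 \<le> r \<Longrightarrow> dsym I (Suc l) b (\<lambda>i. x i + r) > 0"
      "\<And>r. 0 \<le> r \<Longrightarrow> dsym I l b (\<lambda>i. x i + r) > 0"
    and y: "y * dsym I l b x < dsym I (Suc l) b x" and "0 \<le> t"
  shows "y * dsym I l b (\<lambda>i. x i + t) < dsym I (Suc l) b (\<lambda>i. x i + t)"
proof (cases "y \<le> 0")
  case True
  then show ?thesis using pos[OF \<open>0 \<le> t\<close>]
    by (meson le_less_trans less_imp_le mult_nonpos_nonneg)
next
  case False
  define F where "F = (\<lambda>r. dsym I (Suc l) b (\<lambda>i. x i + r))"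
  define F' where "F' = (\<lambda>r. dsym I l b (\<lambda>i. x i + r))"
  define p where "p = esym_op (Suc l) I (\<lambda>i. complex_of_real (b i))
    ((pderiv ^^ (CARD('n) - Suc l)) (linprod (\<lambda>i. of_real (x i))))"
  have F: "poly p (of_real r) = of_real (F r)" for r
    using dsym_eq_poly[OF assms(2), of I "\<lambda>i. complex_of_real (b i)" "\<lambda>i. of_real (x i)" "of_real r"]
      dsym_of_real[of I "Suc l" b "\<lambda>i. x i + r", where 'a = complex]
    by (simp add: p_def F_def)
  have F': "poly (pderiv p) (of_real r) = of_real (F' r)" for r
    using poly_pderiv_dsym[OF assms(2), of I "\<lambda>i. complex_of_real (b i)" "\<lambda>i. of_real (x i)" "of_real r"]
      dsym_of_real[of I l b "\<lambda>i. x i + r", where 'a = complex]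
    by (simp add: p_def F'_def)
  have Fpos: "F r > 0" "F' r > 0" if "r \<ge> 0" for r
    using pos that by (auto simp: F_def F'_def)
  have "poly p 0 \<noteq> 0" using F[of 0] Fpos(1)[of 0] by simp
  then have "p \<noteq> 0" by auto
  then obtain A where A: "\<And>r. r \<in># A \<Longrightarrow> poly p r = 0"
    "\<And>z. poly p z \<noteq> 0 \<Longrightarrow> poly (pderiv p) z = poly p z * (\<Sum>r\<in>#A. 1 / (z - r))"
    using log_derivative by blast
  have "real_rooted p" unfolding p_def using assms by (intro real_rooted_dsym_poly) auto
  then have neg: "r = of_real (Re r) \<and> Re r < 0" if "r \<in># A" for r
  proof -
    have "r \<in> \<real>" using \<open>real_rooted p\<close> A(1)[OF that] by (auto simp: real_rooted_def)
    then have r: "r = of_real (Re r)" by (simp add: of_real_Re)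
    moreover have "\<not> Re r \<ge> 0"
      using F[of "Re r"] Fpos(1)[of "Re r"] A(1)[OF that] r by auto
    ultimately show ?thesis by simp
  qed
  define h where "h = (\<lambda>s. \<Sum>r\<in>#A. 1 / (s - Re r))"
  have h: "F' s = F s * h s" if "s \<ge> 0" for s
  proof -
    have "(\<Sum>r\<in>#A. 1 / (of_real s - r)) = of_real (h s)"
      using neg unfolding h_def
    proof (induction A)
      case (add a A)
      then have "1 / (of_real s - a) = of_real (1 / (s - Re a))"
        by (metis of_real_1 of_real_diff of_real_divide union_single_eq_member)
      then show ?case using add by simp
    qed simp
    moreover have "poly p (of_real s) \<noteq> 0" using F[of s] Fpos(1)[OF that] by simp
    ultimately have "complex_of_real (F' s) = of_real (F s * h s)"
      using A(2)[of "of_real s"] F F' by simp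
    then show ?thesis by (simp only: of_real_eq_iff)
  qed
  have "h t \<le> h 0"
    unfolding h_def by (rule sum_mset_mono) (rule frac_le, use neg \<open>0 \<le> t\<close> in auto)
  moreover have "y * h 0 < 1"
  proof -
    have "F 0 * (y * h 0) < F 0 * 1"
      using y h[of 0] by (simp add: F_def F'_def mult_ac)
    then show ?thesis using Fpos(1)[of 0] by (simp only: mult_less_cancel_left_pos)
  qed
  ultimately have "y * h t < 1"
    using False by (meson le_less_trans mult_left_mono not_le less_imp_le)
  then have "F t * (y * h t) < F t * 1"
    using Fpos(1)[OF \<open>0 \<le> t\<close>] by (simp only: mult_less_cancel_left_pos)
  then show ?thesis using h[OF \<open>0 \<le> t\<close>] by (simp add: F_def F'_def mult_ac)
qed

text \<open>
  The homogenised polynomial \<open>W\<^sub>l\<^sub>+\<^sub>1(x) - y W\<^sub>l(x)\<close> in the variables \<open>(x, z, y)\<close>, evaluated at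
  \<open>u (x0, 1, y0) + s (x1, 1, y1) + t (e, 0, 0)\<close>; the coordinate \<open>z = u + s\<close> multiplies \<open>b\<close>.
\<close>
definition pencil :: "'i set \<Rightarrow> nat \<Rightarrow> ('i \<Rightarrow> 'a) \<Rightarrow> ('n::finite \<Rightarrow> 'a) \<Rightarrow> 'a \<Rightarrow> ('n \<Rightarrow> 'a) \<Rightarrow> 'a \<Rightarrow>
    'a \<Rightarrow> 'a \<Rightarrow> 'a \<Rightarrow> 'a::real_normed_field" where
  "pencil I l b x0 y0 x1 y1 u s t =
     dsym I (Suc l) (\<lambda>i. (u + s) * b i) (\<lambda>j. u * x0 j + s * x1 j + t)
     - (u * y0 + s * y1) * dsym I l (\<lambda>i. (u + s) * b i) (\<lambda>j. u * x0 j + s * x1 j + t)"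

lemma continuous_on_pencil:
  fixes u s t :: "'b::topological_space \<Rightarrow> 'a::real_normed_field"
  assumes "continuous_on S u" "continuous_on S s" "continuous_on S t"
  shows "continuous_on S (\<lambda>p. pencil I l b x0 y0 x1 y1 (u p) (s p) (t p))"
  unfolding pencil_def dsym_def by (intro continuous_intros assms)

lemma pencil_pos:
  fixes x0 x1 :: "'n::finite \<Rightarrow> real"
  assumes "finite I" "Suc l \<le> CARD('n)"
    and x0: "\<And>r. 0 \<le> r \<Longrightarrow> y0 * dsym I l b (\<lambda>i. x0 i + r) < dsym I (Suc l) b (\<lambda>i. x0 i + r)"
    and x1: "\<And>r. 0 \<le> r \<Longrightarrow> y1 * dsym I l b (\<lambda>i. x1 i + r) < dsym I (Suc l) b (\<lambda>i. x1 i + r)"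
    and "0 \<le> u" "0 \<le> s" "0 < t"
  shows "pencil I l b x0 y0 x1 y1 u s t > 0"
proof -
  define g where "g = pencil I l (\<lambda>i. complex_of_real (b i)) (\<lambda>j. of_real (x0 j)) (of_real y0) (\<lambda>j. of_real (x1 j)) (of_real y1)"
  have G: "g (of_real u) (of_real s) (of_real t) = of_real (pencil I l b x0 y0 x1 y1 u s t)" for u s t
    by (simp only: g_def pencil_def of_real_mult[symmetric] of_real_add[symmetric] dsym_of_real of_real_diff[symmetric])
  show ?thesis
  proof (rule hyperbolic_cone_positive[of g "Suc l" "pencil I l b x0 y0 x1 y1"])
    show "continuous_on UNIV (\<lambda>(u, s, t). g u s t)"
      unfolding g_def case_prod_unfold by (intro continuous_on_pencil continuous_intros)
    show "(\<lambda>u. g u s t) holomorphic_on UNIV" for s t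
      unfolding g_def pencil_def dsym_def by (intro holomorphic_intros holomorphic_on_esym)
    show "(\<lambda>s. g u s t) holomorphic_on UNIV" for u t
      unfolding g_def pencil_def dsym_def by (intro holomorphic_intros holomorphic_on_esym)
    show "g (c * u) (c * s) (c * t) = c ^ Suc l * g u s t" for c u s t
    proof -
      have "(\<lambda>i. (c * u + c * s) * of_real (b i)) = (\<lambda>i. c * ((u + s) * complex_of_real (b i)))"
        "(\<lambda>j. c * u * of_real (x0 j) + c * s * of_real (x1 j) + c * t) =
          (\<lambda>j. c * (u * complex_of_real (x0 j) + s * of_real (x1 j) + t))"
        by (auto simp: algebra_simps)
      then show ?thesis
        by (simp only: g_def pencil_def dsym_scale) (simp add: algebra_simps)
    qed
    show "g u s t \<noteq> 0" if "u \<in> \<real>" "s \<in> \<real>" "t \<notin> \<real>" for u s t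
      unfolding g_def pencil_def using that assms(1,2) by (intro dsym_hyperbolic) auto
    show "g 1 0 (of_real r) \<noteq> 0" if "0 \<le> r" for r
    proof -
      have "pencil I l b x0 y0 x1 y1 1 0 r \<noteq> 0" using x0[OF that] by (simp add: pencil_def)
      then show ?thesis using G[of 1 0 r] by simp
    qed
    show "g 0 1 (of_real r) \<noteq> 0" if "0 \<le> r" for r
    proof -
      have "pencil I l b x0 y0 x1 y1 0 1 r \<noteq> 0" using x1[OF that] by (simp add: pencil_def)
      then show ?thesis using G[of 0 1 r] by simp
    qed
    have "(esym UNIV (Suc l) (\<lambda>_ :: 'n. 1 :: real)) = real (CARD('n) choose Suc l)"
      using n_subsets[of "UNIV :: 'n set" "Suc l"] by (simp add: esym_def)
    then have "esym UNIV (Suc l) (\<lambda>_ :: 'n. 1 :: real) > 0"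
      using assms(2) by (simp add: zero_less_binomial)
    then show "pencil I l b x0 y0 x1 y1 0 0 1 > 0"
      using assms(1) by (simp add: pencil_def dsym_zero)
  qed (use assms G in auto)
qed

section \<open>Convexity of the Garding cone and concavity of the quotients\<close>

lemma esym_pos_open:
  fixes x :: "'n::finite \<Rightarrow> real"
  assumes "\<And>j. j \<in> {1..k} \<Longrightarrow> esym UNIV j x > 0"
  shows "\<forall>\<^sub>F \<epsilon> in at_right 0. \<forall>j\<in>{1..k}. esym UNIV j (\<lambda>i. x i - \<epsilon>) > 0"
proof (intro eventually_ball_finite ballI)
  fix j assume j: "j \<in> {1..k}"
  have "continuous_on UNIV (\<lambda>\<epsilon>. esym UNIV j (\<lambda>i. x i - \<epsilon>))"
    by (intro continuous_intros)
  then have "isCont (\<lambda>\<epsilon>. esym UNIV j (\<lambda>i. x i - \<epsilon>)) 0"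
    by (simp add: continuous_on_eq_continuous_at)
  then have "((\<lambda>\<epsilon>. esym UNIV j (\<lambda>i. x i - \<epsilon>)) \<longlongrightarrow> esym UNIV j (\<lambda>i. x i - 0)) (at_right 0)"
    unfolding isCont_def by (rule filterlim_mono) (auto intro: at_le)
  then show "\<forall>\<^sub>F \<epsilon> in at_right 0. esym UNIV j (\<lambda>i. x i - \<epsilon>) > 0"
    using assms[OF j] by (auto dest: order_tendstoD(1))
qed simp

text \<open>
  For \<open>b = 0\<close> and \<open>y = 0\<close> the pencil is a multiple of \<open>\<sigma>\<^sub>k\<close>. As it is known to be positive only
  for \<open>t > 0\<close>, both points are first moved by \<open>-\<epsilon> e\<close>, which keeps them in the open cone, and
  \<open>t = \<epsilon>\<close> moves their combination back.
\<close>
lemma esym_pos_convex: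
  fixes x y :: "'n::finite \<Rightarrow> real"
  assumes "1 \<le> k" "k \<le> CARD('n)"
    and x: "\<And>j. j \<in> {1..k} \<Longrightarrow> esym UNIV j x > 0"
    and y: "\<And>j. j \<in> {1..k} \<Longrightarrow> esym UNIV j y > 0"
    and uv: "0 \<le> u" "0 \<le> v" "u + v = 1"
  shows "esym UNIV k (\<lambda>i. u * x i + v * y i) > 0"
proof -
  have "\<forall>\<^sub>F \<epsilon> in at_right 0. \<epsilon> > 0 \<and> (\<forall>j\<in>{1..k}. esym UNIV j (\<lambda>i. x i - \<epsilon>) > 0) \<and>
      (\<forall>j\<in>{1..k}. esym UNIV j (\<lambda>i. y i - \<epsilon>) > 0)"
    using esym_pos_open[OF x] esym_pos_open[OF y]
    by (intro eventually_conj eventually_at_right_less) auto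
  from eventually_happens'[OF trivial_limit_at_right_real this]
  obtain \<epsilon> :: real where e: "\<epsilon> > 0" "\<forall>j\<in>{1..k}. esym UNIV j (\<lambda>i. x i - \<epsilon>) > 0"
      "\<forall>j\<in>{1..k}. esym UNIV j (\<lambda>i. y i - \<epsilon>) > 0"
    by blast
  obtain l where l: "k = Suc l" using assms(1) by (cases k) auto
  have shift: "0 < dsym {} k (\<lambda>_ :: nat. 0) (\<lambda>i. z i + r)"
    if "\<forall>j\<in>{1..k}. esym UNIV j z > 0" "0 \<le> r" for z :: "'n \<Rightarrow> real" and r
    using esym_shift_pos[of k z r] that assms(2) by (simp add: dsym_zero)
  have "pencil {} l (\<lambda>_ :: nat. 0) (\<lambda>i. x i - \<epsilon>) 0 (\<lambda>i. y i - \<epsilon>) 0 u v \<epsilon> > 0"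
    using shift e assms(2) uv unfolding l by (intro pencil_pos) auto
  moreover have "u * (x i - \<epsilon>) + v * (y i - \<epsilon>) + \<epsilon> = u * x i + v * y i" for i
  proof -
    have "u * (x i - \<epsilon>) + v * (y i - \<epsilon>) + \<epsilon> = u * x i + v * y i + (1 - (u + v)) * \<epsilon>"
      by (simp add: algebra_simps)
    then show ?thesis using uv by simp
  qed
  ultimately show ?thesis
    by (simp add: pencil_def dsym_zero l zero_less_mult_iff)
qed

lemma Garding_cone_iff: "x \<in> Garding_cone k \<longleftrightarrow> (\<forall>j\<in>{1..k}. esym UNIV j (($) x) > 0)"
  by (simp add: Garding_cone_def elem_sigma_def elem_sym_eq_esym)

lemma vec_nth_combination: "($) (u *\<^sub>R x + v *\<^sub>R y) = (\<lambda>i. u * x $ i + v * y $ i)"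
  for x y :: "real ^ 'n"
  by (simp add: fun_eq_iff)

lemma convex_Garding_cone:
  assumes "k \<le> CARD('n)"
  shows "convex (Garding_cone k :: (real ^ 'n) set)"
proof (rule convexI)
  fix x y :: "real ^ 'n" and u v :: real
  assume *: "x \<in> Garding_cone k" "y \<in> Garding_cone k" "0 \<le> u" "0 \<le> v" "u + v = 1"
  have "esym UNIV j (\<lambda>i. u * x $ i + v * y $ i) > 0" if "j \<in> {1..k}" for j
    using * that assms by (intro esym_pos_convex) (auto simp: Garding_cone_iff)
  then show "u *\<^sub>R x + v *\<^sub>R y \<in> Garding_cone k"
    unfolding Garding_cone_iff vec_nth_combination by blast
qed

lemma dsym_pos:
  fixes x :: "'n::finite \<Rightarrow> real"
  assumes "finite I" and b: "\<And>m. m \<le> l \<Longrightarrow> 0 \<le> esym I m b"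
    and x: "\<And>j. j \<in> {1..l} \<Longrightarrow> esym UNIV j x > 0"
  shows "dsym I l b x > 0"
proof -
  have x': "esym UNIV j x > 0" if "j \<le> l" for j
    using x[of j] that by (cases "j = 0") auto
  have "0 < fact (CARD('n) - l + 0) * esym I 0 b * esym UNIV (l - 0) x"
    using x'[of l] assms(1) by simp
  also have "\<dots> \<le> dsym I l b x"
    unfolding dsym_def
    by (rule member_le_sum) (use b x' in \<open>auto intro!: mult_nonneg_nonneg simp: less_imp_le\<close>)
  finally show ?thesis .
qed

text \<open>
  The heights \<open>f x - e\<close> and \<open>f y - e\<close> give two points of the hyperbolicity cone. Positivity of the
  pencil on their convex combination for \<open>t > 0\<close> yields, in the limits \<open>t \<rightarrow> 0\<close> and \<open>e \<rightarrow> 0\<close>,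
  the concavity inequality.
\<close>
lemma concave_on_dsym_ratio:
  fixes b :: "'i \<Rightarrow> real"
  assumes "finite I" "k \<le> CARD('n)" "Suc l \<le> k"
    and b: "\<And>m. m \<le> k \<Longrightarrow> 0 \<le> esym I m b"
  shows "concave_on (Garding_cone k :: (real ^ 'n) set) (\<lambda>x. dsym I (Suc l) b (($) x) / dsym I l b (($) x))"
  unfolding concave_on_iff
proof (intro conjI ballI allI impI)
  show "convex (Garding_cone k :: (real ^ 'n) set)" using assms by (intro convex_Garding_cone)
  have pos: "0 < dsym I j b (\<lambda>i. x $ i + r)" if "x \<in> Garding_cone k" "j \<le> k" "0 \<le> r" for x :: "real ^ 'n" and j r
    using that assms by (intro dsym_pos b esym_shift_pos) (auto simp: Garding_cone_iff)
  define f where "f = (\<lambda>x :: real ^ 'n. dsym I (Suc l) b (($) x) / dsym I l b (($) x))"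
  fix x y :: "real ^ 'n" and u v :: real
  assume x: "x \<in> Garding_cone k" and y: "y \<in> Garding_cone k" and uv: "0 \<le> u" "0 \<le> v" "u + v = 1"
  define z where "z = u *\<^sub>R x + v *\<^sub>R y"
  have z: "z \<in> Garding_cone k"
    unfolding z_def using convex_Garding_cone[OF assms(2)] x y uv by (intro convexD)
  have ray: "(f w - e) * dsym I l b (\<lambda>i. w $ i + r) < dsym I (Suc l) b (\<lambda>i. w $ i + r)"
    if w: "w \<in> Garding_cone k" and "e > 0" "0 \<le> r" for w e r
  proof (rule dsym_ratio_along_ray)
    have "f w * dsym I l b (($) w) = dsym I (Suc l) b (($) w)"
      using pos[OF w, of l 0] assms(3) by (simp add: f_def)
    moreover have "e * dsym I l b (($) w) > 0" using pos[OF w, of l 0] \<open>e > 0\<close> assms(3) by simp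
    ultimately show "(f w - e) * dsym I l b (($) w) < dsym I (Suc l) b (($) w)"
      by (simp add: left_diff_distrib)
  qed (use pos[OF w] that assms in auto)
  have "u * f x + v * f y \<le> f z"
  proof (rule field_le_epsilon)
    fix e :: real assume e: "e > 0"
    define p where "p = (\<lambda>t. pencil I l b (($) x) (f x - e) (($) y) (f y - e) u v t)"
    have "p t > 0" if "t > 0" for t
      unfolding p_def using ray[OF x e] ray[OF y e] assms that uv by (intro pencil_pos) auto
    then have "\<forall>\<^sub>F t in at_right 0. 0 \<le> p t"
      by (auto simp: eventually_at_right_field intro!: exI[of _ 1] less_imp_le)
    moreover have "continuous_on UNIV p" unfolding p_def by (intro continuous_on_pencil continuous_intros)
    then have "(p \<longlongrightarrow> p 0) (at_right 0)"
      by (metis UNIV_I continuous_on_def tendsto_within_subset subset_UNIV)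
    ultimately have "0 \<le> p 0"
      by (metis tendsto_lowerbound trivial_limit_at_right_real)
    moreover have "p 0 = dsym I (Suc l) b (($) z) - (u * f x + v * f y - e) * dsym I l b (($) z)"
    proof -
      have "u * (f x - e) + v * (f y - e) = u * f x + v * f y - (u + v) * e"
        by (simp add: algebra_simps)
      then show ?thesis using uv by (simp add: p_def pencil_def z_def vec_nth_combination)
    qed
    moreover have "dsym I (Suc l) b (($) z) = f z * dsym I l b (($) z)"
      using pos[OF z, of l 0] assms(3) by (simp add: f_def)
    ultimately have "(u * f x + v * f y - e) * dsym I l b (($) z) \<le> f z * dsym I l b (($) z)"
      by simp
    then show "u * f x + v * f y \<le> f z + e"
      using pos[OF z, of l 0] assms(3) by simp
  qed
  then show "dsym I (Suc l) b (($) (u *\<^sub>R x + v *\<^sub>R y)) / dsym I l b (($) (u *\<^sub>R x + v *\<^sub>R y))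
      \<ge> u * (dsym I (Suc l) b (($) x) / dsym I l b (($) x)) + v * (dsym I (Suc l) b (($) y) / dsym I l b (($) y))"
    by (simp add: f_def z_def)
qed

text \<open>
  For \<open>z = u x + v y\<close>, divide by the value at \<open>z\<close> and apply the inequality of arithmetic and
  geometric means to the ratios \<open>f j x / f j z\<close> and \<open>f j y / f j z\<close>: the weighted means of these
  ratios are at most \<open>1\<close>.
\<close>
lemma concave_on_geometric_mean:
  fixes f :: "'i \<Rightarrow> 'a::real_vector \<Rightarrow> real"
  assumes J: "finite J" "J \<noteq> {}"
    and conc: "\<And>j. j \<in> J \<Longrightarrow> concave_on S (f j)"
    and pos: "\<And>j x. j \<in> J \<Longrightarrow> x \<in> S \<Longrightarrow> f j x > 0"
  shows "concave_on S (\<lambda>x. (\<Prod>j\<in>J. f j x) powr (1 / card J))"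
  unfolding concave_on_iff
proof (intro conjI ballI allI impI)
  show S: "convex S" using J conc concave_on_imp_convex by blast
  fix x y u v assume *: "x \<in> S" "y \<in> S" "(0::real) \<le> u" "(0::real) \<le> v" "u + v = 1"
  define z where "z = u *\<^sub>R x + v *\<^sub>R y"
  have z: "z \<in> S" unfolding z_def using S * by (intro convexD)
  define G where "G = (\<lambda>x. (\<Prod>j\<in>J. f j x) powr (1 / card J))"
  have "(\<Prod>j\<in>J. f j z) > 0" using pos z by (intro prod_pos) auto
  then have Gz: "G z > 0" unfolding G_def powr_gt_zero by (rule less_imp_neq[symmetric])
  have quot: "G w / G z \<le> (\<Sum>j\<in>J. f j w / f j z / card J)" if w: "w \<in> S" for w
  proof -
    have "G w / G z = (\<Prod>j\<in>J. f j w / f j z) powr (1 / card J)"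
      using pos w z by (simp add: G_def prod_dividef powr_divide prod_nonneg less_imp_le)
    also have "\<dots> \<le> (\<Sum>j\<in>J. f j w / f j z / card J)"
      using pos w z J by (intro arith_geom_mean) (auto intro!: divide_nonneg_nonneg simp: less_imp_le)
    finally show ?thesis .
  qed
  have "(u * G x + v * G y) / G z = u * (G x / G z) + v * (G y / G z)"
    by (simp add: add_divide_distrib)
  also have "\<dots> \<le> u * (\<Sum>j\<in>J. f j x / f j z / card J) + v * (\<Sum>j\<in>J. f j y / f j z / card J)"
    using * quot by (intro add_mono mult_left_mono) auto
  also have "\<dots> = (\<Sum>j\<in>J. (u * f j x + v * f j y) / f j z / card J)"
    by (simp add: sum_distrib_left sum.distrib add_divide_distrib)
  also have "\<dots> \<le> (\<Sum>j\<in>J. 1 / card J)"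
  proof (rule sum_mono)
    fix j assume j: "j \<in> J"
    have "u * f j x + v * f j y \<le> f j z"
      using conc[OF j] * unfolding concave_on_iff z_def by blast
    then have "(u * f j x + v * f j y) / f j z \<le> 1" using pos[OF j z] by simp
    then show "(u * f j x + v * f j y) / f j z / card J \<le> 1 / card J"
      by (rule divide_right_mono) simp
  qed
  also have "\<dots> = 1" using J by simp
  finally have "u * G x + v * G y \<le> G z" using Gz by simp
  then show "u * (\<Prod>j\<in>J. f j x) powr (1 / card J) + v * (\<Prod>j\<in>J. f j y) powr (1 / card J)
      \<le> (\<Prod>j\<in>J. f j (u *\<^sub>R x + v *\<^sub>R y)) powr (1 / card J)"
    by (simp add: G_def z_def)
qed

section \<open>The concave quotients of \<open>Q\<close>\<close>

theorem theorem3: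
  fixes k N :: nat and \<alpha> b :: "nat \<Rightarrow> real" and Q :: "real ^ 'n \<Rightarrow> real"
  assumes "1 \<le> k" and "k \<le> CARD('n)"
    and "\<And>s. s \<le> k \<Longrightarrow> 0 \<le> \<alpha> s" and "0 < \<alpha> k"
    and "Q = (\<lambda>x. \<Sum>s=0..k. \<alpha> s * elem_sigma s x)"
    and "k \<le> N"
    and "\<And>m. m \<le> k \<Longrightarrow>
      fact (CARD('n) - k) * \<alpha> (k - m) / fact (CARD('n) - k + m) = elem_sym {..<N} m b"
  shows "\<exists>S :: nat \<Rightarrow> real ^ 'n \<Rightarrow> real. \<forall>l\<in>{1..k - 1}.
      (\<exists>\<beta> :: nat \<Rightarrow> real. (\<forall>s<l. 0 \<le> \<beta> s) \<and>
         S l = (\<lambda>x. elem_sigma l x + (\<Sum>s=0..<l. \<beta> s * elem_sigma s x))) \<and>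
      concave_on (Garding_cone k) (\<lambda>x. (Q x / S l x) powr (1 / real (k - l)))"
proof -
  define n where "n = CARD('n)"
  define e where "e = (\<lambda>m. esym {..<N} m b)"
  define W where "W = (\<lambda>l (x :: real ^ 'n). dsym {..<N} l b (($) x))"
  define S where "S = (\<lambda>l x. W l x / fact (n - l))"
  have coeffs: "fact (n - k) * \<alpha> (k - m) = fact (n - k + m) * e m" if "m \<le> k" for m
    using assms(7)[OF that] by (simp add: n_def e_def elem_sym_eq_esym field_simps)
  have e_nonneg: "0 \<le> e m" if "m \<le> k" for m
    using assms(7)[OF that] assms(3)[of "k - m"]
    by (simp add: e_def flip: elem_sym_eq_esym) (metis divide_nonneg_pos fact_gt_zero mult_nonneg_nonneg fact_ge_zero)
  have W_sum: "W l x = (\<Sum>s\<le>l. fact (n - s) * e (l - s) * elem_sigma s x)" if "l \<le> n" for l x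
  proof -
    have "W l x = (\<Sum>m\<le>l. fact (n - (l - m)) * e m * elem_sigma (l - m) x)"
      unfolding W_def dsym_def using that
      by (intro sum.cong) (auto simp: n_def e_def elem_sigma_def elem_sym_eq_esym)
    also have "\<dots> = (\<Sum>s\<le>l. fact (n - s) * e (l - s) * elem_sigma s x)"
      by (rule sum.reindex_bij_witness[of _ "\<lambda>s. l - s" "\<lambda>s. l - s"]) auto
    finally show ?thesis .
  qed
  have e0: "e 0 = 1" by (simp add: e_def)
  have Q: "Q x = W k x / fact (n - k)" for x
  proof -
    have "fact (n - s) * e (k - s) * elem_sigma s x / fact (n - k) = \<alpha> s * elem_sigma s x" if "s \<le> k" for s
    proof -
      have "n - k + (k - s) = n - s" using that assms(2) by (simp add: n_def)
      then show ?thesis using coeffs[of "k - s"] that by (simp add: field_simps)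
    qed
    then show ?thesis
      using assms(2) by (simp add: assms(5) W_sum n_def sum_divide_distrib atLeast0AtMost)
  qed
  have W_pos: "W l x > 0" if "x \<in> Garding_cone k" "l \<le> k" for l x
    unfolding W_def using that e_nonneg
    by (intro dsym_pos) (auto simp: Garding_cone_iff e_def)
  show ?thesis
  proof (intro exI[of _ S] ballI conjI)
    fix l assume l: "l \<in> {1..k - 1}"
    then have lk: "l < k" "l \<le> n" using assms(2) by (auto simp: n_def)
    define \<beta> where "\<beta> = (\<lambda>s. fact (n - s) * e (l - s) / fact (n - l))"
    have "S l x = elem_sigma l x + (\<Sum>s=0..<l. \<beta> s * elem_sigma s x)" for x
      using lk(2)
      by (simp add: S_def W_sum \<beta>_def e0 atLeast0LessThan lessThan_Suc_atMost[symmetric] add_divide_distrib sum_divide_distrib)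
    moreover have "0 \<le> \<beta> s" if "s < l" for s
      using e_nonneg[of "l - s"] lk by (simp add: \<beta>_def)
    ultimately show "\<exists>\<beta>. (\<forall>s<l. 0 \<le> \<beta> s) \<and> S l = (\<lambda>x. elem_sigma l x + (\<Sum>s=0..<l. \<beta> s * elem_sigma s x))"
      by blast
    define C :: real where "C = fact (n - l) / fact (n - k)"
    define P where "P = (\<lambda>x. \<Prod>j\<in>{l..<k}. W (Suc j) x / W j x)"
    have "concave_on (Garding_cone k) (\<lambda>x. P x powr (1 / card {l..<k}))"
      unfolding P_def
    proof (rule concave_on_geometric_mean)
      show "concave_on (Garding_cone k) (\<lambda>x. W (Suc j) x / W j x)" if "j \<in> {l..<k}" for j
        unfolding W_def using that assms(2) e_nonneg
        by (intro concave_on_dsym_ratio) (auto simp: e_def)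
    qed (use W_pos lk in auto)
    then have "concave_on (Garding_cone k) (\<lambda>x. C powr (1 / real (k - l)) * P x powr (1 / real (k - l)))"
      by (intro concave_on_cmul) auto
    moreover have "(Q x / S l x) powr (1 / real (k - l)) = C powr (1 / real (k - l)) * P x powr (1 / real (k - l))"
      if x: "x \<in> Garding_cone k" for x
    proof -
      have "(\<Prod>j\<in>{l..<l + d}. W (Suc j) x / W j x) = W (l + d) x / W l x" if "l + d \<le> k" for d
        using that
      proof (induction d)
        case 0
        then show ?case using W_pos[OF x, of l] by simp
      next
        case (Suc d)
        then show ?case using W_pos[OF x, of "l + d"] by simp
      qed
      from this[of "k - l"] have P: "P x = W k x / W l x" using lk by (simp add: P_def)
      then have "P x > 0" using W_pos[OF x] lk by simp
      have "Q x / S l x = C * P x" by (simp add: Q S_def C_def P)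
      moreover have "C > 0" by (simp add: C_def)
      ultimately show ?thesis using \<open>P x > 0\<close> by (simp only: powr_mult)
    qed
    ultimately show "concave_on (Garding_cone k) (\<lambda>x. (Q x / S l x) powr (1 / real (k - l)))"
      by (simp add: concave_on_iff convexD)
  qed
qed

end
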